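(* Let $q$ be a prime power, let $\Gamma$ be the group $\mathrm{PSL}_2(q)$ and let $n=|\Gamma|$. Then $\Gamma$ has no product-free subset of cardinality greater than $2n^{8/9}$.
   Context: $\mathrm{PSL}_2(q)$ is the group of all $2\times 2$ matrices of determinant $1$ over the finite field $\mathbb{F}_q$, quotiented by the subgroup $\{I,-I\}$. A subset $X$ of a group is product-free if there do not exist (not necessarily distinct) elements $x,y,z\in X$ with $xy=z$. *)

theory Defs
  imports
    "HOL-Analysis.Determinants"
    "HOL-Algebra.Coset"
    "HOL-Number_Theory.Prime_Powers"
begin

definition SL2 :: "('k::field^2^2) monoid" where
  "SL2 = \<lparr>carrier = {A. det A = 1}, mult = (**), one = mat 1\<rparr>"

text \<open>In characteristic 2 the set below collapses to the trivial subgroup.\<close>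

definition PSL2 :: "('k::field^2^2) set monoid" where
  "PSL2 = SL2 Mod {mat 1, - mat 1}"

definition product_free :: "('a, 'b) monoid_scheme \<Rightarrow> 'a set \<Rightarrow> bool" where
  "product_free G X \<longleftrightarrow>
     X \<subseteq> carrier G \<and> \<not> (\<exists>x\<in>X. \<exists>y\<in>X. \<exists>z\<in>X. x \<otimes>\<^bsub>G\<^esub> y = z)"

lemma matrix_mul_neg:
  fixes A B :: "'k::field^2^2"
  shows "(- A) ** B = - (A ** B)" and "A ** (- B) = - (A ** B)"
  by (simp_all add: matrix_matrix_mult_def vec_eq_iff sum_negf)

lemma group_SL2: "group (SL2 :: ('k::field^2^2) monoid)"
proof (rule groupI)
  fix A :: "'k^2^2"
  assume "A \<in> carrier SL2"
  then have dA: "det A = 1"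
    by (simp add: SL2_def)
  then obtain B where B: "A ** B = mat 1" "B ** A = mat 1"
    using invertible_det_nz[of A] by (auto simp: invertible_def)
  then have "det B = 1"
    using det_mul[of B A] dA by simp
  with B show "\<exists>B\<in>carrier SL2. B \<otimes>\<^bsub>SL2\<^esub> A = \<one>\<^bsub>SL2\<^esub>"
    by (auto simp: SL2_def)
qed (auto simp: SL2_def det_mul matrix_mul_assoc)

lemma normal_center_SL2: "{mat 1, - mat 1} \<lhd> (SL2 :: ('k::field^2^2) monoid)"
proof -
  let ?G = "SL2 :: ('k^2^2) monoid"
  interpret group ?G
    by (rule group_SL2)
  have car: "mat 1 \<in> carrier ?G" "- mat 1 \<in> carrier ?G"
    by (simp_all add: SL2_def det_2 mat_def)
  have inv_neg: "inv\<^bsub>?G\<^esub> (- mat 1) = - mat 1"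
    by (rule inv_equality) (use car in \<open>auto simp: SL2_def matrix_mul_neg\<close>)
  have inv_one': "inv\<^bsub>?G\<^esub> (mat 1) = mat 1"
    by (rule inv_equality) (use car in \<open>auto simp: SL2_def\<close>)
  have sub: "subgroup {mat 1, - mat 1} ?G"
  proof (rule subgroupI)
    fix A B
    assume "A \<in> {mat 1, - mat 1 :: 'k^2^2}" "B \<in> {mat 1, - mat 1 :: 'k^2^2}"
    then show "A \<otimes>\<^bsub>?G\<^esub> B \<in> {mat 1, - mat 1}"
      by (auto simp: SL2_def matrix_mul_neg)
  qed (use car inv_neg inv_one' in auto)
  have "A \<otimes>\<^bsub>?G\<^esub> h \<otimes>\<^bsub>?G\<^esub> inv\<^bsub>?G\<^esub> A \<in> {mat 1, - mat 1}"
    if "A \<in> carrier ?G" "h \<in> {mat 1, - mat 1}" for A h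
  proof -
    have "A ** inv\<^bsub>?G\<^esub> A = mat 1"
      using r_inv[OF that(1)] by (simp add: SL2_def)
    then show ?thesis
      using that(2) by (auto simp: SL2_def matrix_mul_neg)
  qed
  with sub show ?thesis
    by (auto simp: normal_inv_iff)
qed

lemma group_PSL2: "group (PSL2 :: ('k::field^2^2) set monoid)"
  unfolding PSL2_def by (rule normal.factorgroup_is_group[OF normal_center_SL2])

end

theory Submission
  imports
    Defs
    "HOL-Analysis.Convex"
    "HOL-Number_Theory.Cong"
begin

text \<open>Gowers' argument, with representation theory replaced by a computation inside \<open>SL2\<close>.
  Let \<open>N\<close> be the order of \<open>SL2\<close>. It suffices that convolution \<open>T\<close> by a function \<open>h\<close> has squared
  norm at most \<open>(4 / (q - 1) + 1 / q) * N * \<parallel>h\<parallel>\<^sup>2\<close> on functions of sum zero. Since \<open>T\<close> commutes with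
  right translations, functions can be decomposed under the right action of the unipotent subgroup
  \<open>U\<close>. For a component belonging to a nontrivial character of \<open>U\<close>, each of its \<open>q - 1\<close> translates
  by the diagonal torus is orthogonal to all but at most four of them, and all have images of the
  same norm under \<open>T\<close>, so the Hilbert-Schmidt norm of \<open>T\<close>, whose square is \<open>N * \<parallel>h\<parallel>\<^sup>2\<close>, bounds this norm.
  A \<open>U\<close>-invariant function of sum zero is translated by the Weyl element: by the Bruhat
  decomposition at most a proportion \<open>1 / q\<close> of its squared norm is still \<open>U\<close>-invariant, and for
  that part the trivial bound on \<open>T\<close> suffices.\<close>

section \<open>A cosine character of a finite field\<close>

text \<open>For an additive subgroup \<open>H\<close> that is maximal among those avoiding 1, the
  integer multiples of 1 represent all cosets. Reading off the integer modulo \<open>p\<close> gives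
  a nonzero linear form over the prime field without choosing a basis.\<close>

lemma exists_additive_mod_CHAR:
  "\<exists>J :: 'k::{field,finite} \<Rightarrow> int.
     (\<forall>x y. [J (x + y) = J x + J y] (mod int CHAR('k))) \<and> [J 1 = 1] (mod int CHAR('k))"
proof -
  define p where "p = int CHAR('k)"
  define \<H> where
    "\<H> = {H :: 'k set. 0 \<in> H \<and> (\<forall>x\<in>H. \<forall>y\<in>H. x - y \<in> H) \<and> 1 \<notin> H}"
  have primeC: "prime CHAR('k)"
    by (rule prime_CHAR_semidom) (rule finite_imp_CHAR_pos, simp)
  then have p: "prime p"
    by (simp add: p_def)
  have "{0} \<in> \<H>" by (simp add: \<H>_def)
  then have "Max (card ` \<H>) \<in> card ` \<H>"
    by (intro Max_in) auto
  then obtain H where H: "H \<in> \<H>" and "card H = Max (card ` \<H>)"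
    by (metis imageE)
  then have max: "card H' \<le> card H" if "H' \<in> \<H>" for H'
    using that by simp
  have 0: "0 \<in> H" and 1: "1 \<notin> H" and diff: "\<And>x y. x \<in> H \<Longrightarrow> y \<in> H \<Longrightarrow> x - y \<in> H"
    using H by (auto simp: \<H>_def)
  have minus: "- x \<in> H" if "x \<in> H" for x
    using diff[OF 0 that] by simp
  have add: "x + y \<in> H" if "x \<in> H" "y \<in> H" for x y
    using diff[OF that(1) minus[OF that(2)]] by simp
  have mult_nat: "of_nat m * x \<in> H" if "x \<in> H" for x m
    by (induction m) (auto simp: 0 algebra_simps intro: add that)
  have mult: "of_int m * x \<in> H" if "x \<in> H" for x m
    by (cases m rule: int_cases2) (use mult_nat[OF that] minus in auto)
  have inverse: "\<exists>i. of_int i * (of_int j :: 'k) = 1" if "\<not> p dvd j" for j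
  proof -
    have "coprime j p"
      using prime_imp_coprime[OF p that] by (simp only: coprime_commute)
    then obtain i where "[j * i = 1] (mod p)"
      using cong_solve_coprime_int by blast
    then have "p dvd j * i - 1"
      by (simp add: cong_iff_dvd_diff)
    then have "of_int (j * i - 1) = (0 :: 'k)"
      by (simp only: of_int_eq_0_iff_char_dvd p_def)
    then show ?thesis
      by (intro exI[of _ i]) (simp add: mult.commute)
  qed
  have p_zero: "of_int j = (0 :: 'k)" if "p dvd j" for j
    using that by (simp only: of_int_eq_0_iff_char_dvd p_def)
  have int_in_H: "p dvd j" if "of_int j \<in> H" for j
    using inverse[of j] mult[OF that] 1 by metis
  have "\<exists>j. x - of_int j \<in> H" for x
  proof (rule ccontr)
    assume no: "\<nexists>j. x - of_int j \<in> H"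
    \<comment> \<open>Adjoining the multiples of \<open>x\<close> enlarges \<open>H\<close>
      strictly, so by maximality 1 enters \<open>H'\<close>. Solving for \<open>x\<close> then makes
      it an integer modulo \<open>H\<close>, contrary to \<open>no\<close>.\<close>
    define H' where "H' = {h + of_int j * x | h j. h \<in> H}"
    have "H \<subseteq> H'"
      unfolding H'_def by (force intro: exI[of _ 0])
    moreover have "x \<in> H'"
      unfolding H'_def using 0 by (force intro: exI[of _ 1])
    moreover have "x \<notin> H"
      using no[unfolded not_ex, rule_format, of 0] by simp
    ultimately have "card H < card H'"
      by (intro psubset_card_mono) auto
    then have "H' \<notin> \<H>"
      using max[of H'] by auto
    moreover have "0 \<in> H'"
      using \<open>H \<subseteq> H'\<close> 0 by auto
    moreover have "y - z \<in> H'" if yz: "y \<in> H'" "z \<in> H'" for y z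
    proof -
      obtain h j h' j' where "y = h + of_int j * x" "z = h' + of_int j' * x" "h \<in> H" "h' \<in> H"
        using yz unfolding H'_def by blast
      then show ?thesis
        unfolding H'_def
        by (intro CollectI exI[of _ "h - h'"] exI[of _ "j - j'"]) (auto simp: algebra_simps diff)
    qed
    ultimately have "1 \<in> H'"
      by (auto simp: \<H>_def)
    then obtain h j where hj: "h \<in> H" "1 = h + of_int j * x"
      by (auto simp: H'_def)
    have "\<not> p dvd j"
      using hj 1 p_zero[of j] by auto
    then obtain i where i: "of_int i * (of_int j :: 'k) = 1"
      using inverse by blast
    have "of_int i = of_int i * (h + of_int j * x)"
      by (simp flip: hj(2))
    also have "\<dots> = of_int i * h + x"
      using i by (simp add: distrib_left flip: mult.assoc)
    finally have "x - of_int i = - (of_int i * h)"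
      by (simp add: algebra_simps)
    then show False
      using no minus[OF mult[OF hj(1)]] by metis
  qed
  then obtain J where J: "\<And>x. x - of_int (J x) \<in> H"
    by metis
  have "[J (x + y) = J x + J y] (mod p)" for x y
  proof -
    have "(x - of_int (J x)) + (y - of_int (J y)) - (x + y - of_int (J (x + y))) \<in> H"
      by (intro diff add J)
    then have "of_int (J (x + y) - (J x + J y)) \<in> H"
      by (simp add: diff_diff_eq2 diff_diff_eq add_ac)
    then show ?thesis
      using int_in_H by (simp add: cong_iff_dvd_diff)
  qed
  moreover have "[J 1 = 1] (mod p)"
  proof -
    have "of_int (1 - J 1) \<in> H"
      using J[of 1] by simp
    then show ?thesis
      using int_in_H by (simp add: cong_iff_dvd_diff dvd_diff_commute)
  qed
  ultimately show ?thesis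
    unfolding p_def by blast
qed

text \<open>Take the real part of the character exp(2 pi i J(x) / p). The product formula for
  cosines replaces multiplicativity, so all later functions stay real-valued.\<close>

lemma exists_cosine_character:
  "\<exists>C :: 'k::{field,finite} \<Rightarrow> real.
     (\<forall>x y. C (x + y) + C (x - y) = 2 * C x * C y) \<and> C 0 = 1 \<and> (\<exists>y. C y \<noteq> 1)"
proof -
  define p where "p = CHAR('k)"
  have "prime p"
    unfolding p_def by (rule prime_CHAR_semidom) (rule finite_imp_CHAR_pos, simp)
  then have p: "p \<ge> 2" by (rule prime_ge_2_nat)
  obtain J :: "'k \<Rightarrow> int" where J: "\<And>x y. [J (x + y) = J x + J y] (mod int p)"
    and J1: "[J 1 = 1] (mod int p)"
    using exists_additive_mod_CHAR unfolding p_def by blast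
  define \<theta> :: "int \<Rightarrow> real" where "\<theta> j = 2 * pi * real_of_int j / real p" for j
  define C where "C x = cos (\<theta> (J x))" for x
  have period: "cos (\<theta> i) = cos (\<theta> j)" if ij: "[i = j] (mod int p)" for i j
  proof -
    obtain k where "i = j + int p * k"
      using cong_iff_lin[of j i] cong_sym[OF ij] by auto
    then have "\<theta> i = \<theta> j + 2 * pi * of_int k"
      using p by (simp add: \<theta>_def add_divide_distrib ring_distribs)
    then show ?thesis
      by (simp add: cos_add)
  qed
  have minus: "[J (x - y) = J x - J y] (mod int p)" for x y
    using cong_sym[OF J[of "x - y" y]] by (simp add: cong_iff_dvd_diff diff_diff_eq2)
  have "C (x + y) + C (x - y) = 2 * C x * C y" for x y
  proof -
    have "C (x + y) = cos (\<theta> (J x) + \<theta> (J y))"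
      unfolding C_def period[OF J] by (simp add: \<theta>_def add_divide_distrib diff_divide_distrib ring_distribs)
    moreover have "C (x - y) = cos (\<theta> (J x) - \<theta> (J y))"
      unfolding C_def period[OF minus] by (simp add: \<theta>_def add_divide_distrib diff_divide_distrib ring_distribs)
    ultimately show ?thesis
      by (simp add: C_def cos_add cos_diff)
  qed
  moreover have "C 0 = 1"
    using period[OF minus[of 0 0]] by (simp add: C_def \<theta>_def)
  moreover have "C 1 \<noteq> 1"
  proof -
    have "C 1 = cos (2 * pi / real p)"
      using period[OF J1] by (simp add: C_def \<theta>_def)
    \<comment> \<open>Since \<open>p \<ge> 2\<close>, the angle 2 pi / p lies between 0 and pi,
      where cosine decreases strictly.\<close>
    also have "\<dots> < cos 0"
      using p by (intro cos_monotone_0_pi) (auto simp: field_simps)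
    finally show ?thesis by simp
  qed
  ultimately show ?thesis by blast
qed

section \<open>Real functions on a finite group\<close>

locale fin_group = group G for G (structure) +
  assumes finite_carrier: "finite (carrier G)"
begin

definition ip :: "('a \<Rightarrow> real) \<Rightarrow> ('a \<Rightarrow> real) \<Rightarrow> real" where
  "ip f g = (\<Sum>x\<in>carrier G. f x * g x)"

text \<open>\<open>h\<close> acts by left translations, which is why the operator commutes with
  right translations.\<close>

definition conv :: "('a \<Rightarrow> real) \<Rightarrow> ('a \<Rightarrow> real) \<Rightarrow> 'a \<Rightarrow> real" where
  "conv h f x = (\<Sum>z\<in>carrier G. h z * f (inv z \<otimes> x))"

lemma ip_cong:
  "(\<And>x. x \<in> carrier G \<Longrightarrow> f x = f' x) \<Longrightarrow> (\<And>x. x \<in> carrier G \<Longrightarrow> g x = g' x) \<Longrightarrow> ip f g = ip f' g'"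
  unfolding ip_def by (rule sum.cong) auto

lemma ip_nonneg: "ip f f \<ge> 0"
  unfolding ip_def by (simp add: sum_nonneg)

lemma ip_commute: "ip f g = ip g f"
  by (simp add: ip_def mult.commute)

lemma ip_scale_left: "ip (\<lambda>x. c * f x) g = c * ip f g"
  by (simp add: ip_def sum_distrib_left mult.assoc)

lemma ip_scale_right: "ip f (\<lambda>x. c * g x) = c * ip f g"
  by (simp add: ip_def sum_distrib_left mult_ac)

lemma ip_sum_right: "ip f (\<lambda>x. \<Sum>i\<in>I. g i x) = (\<Sum>i\<in>I. ip f (g i))"
  unfolding ip_def by (simp add: sum_distrib_left) (rule sum.swap)

lemma ip_sum_left: "ip (\<lambda>x. \<Sum>i\<in>I. g i x) f = (\<Sum>i\<in>I. ip (g i) f)"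
  using ip_sum_right by (simp add: ip_commute)

lemma ip_Cauchy_Schwarz: "(ip f g)\<^sup>2 \<le> ip f f * ip g g"
  unfolding ip_def using Cauchy_Schwarz_ineq_sum[of f g "carrier G"]
  by (simp add: power2_eq_square)

lemma sum_translate_right:
  assumes "g \<in> carrier G"
  shows "(\<Sum>x\<in>carrier G. f (x \<otimes> g)) = (\<Sum>x\<in>carrier G. f x)"
  by (rule sum.reindex_bij_witness[of _ "\<lambda>x. x \<otimes> inv g" "\<lambda>x. x \<otimes> g"])
     (use assms in \<open>auto simp: m_assoc\<close>)

lemma sum_translate_left:
  assumes "g \<in> carrier G"
  shows "(\<Sum>x\<in>carrier G. f (g \<otimes> x)) = (\<Sum>x\<in>carrier G. f x)"
  by (rule sum.reindex_bij_witness[of _ "\<lambda>x. inv g \<otimes> x" "\<lambda>x. g \<otimes> x"])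
     (use assms in \<open>auto simp flip: m_assoc\<close>)

lemma sum_inv: "(\<Sum>x\<in>carrier G. f (inv x)) = (\<Sum>x\<in>carrier G. f x)"
  by (rule sum.reindex_bij_witness[of _ "\<lambda>x. inv x" "\<lambda>x. inv x"]) auto

lemma ip_translate:
  "g \<in> carrier G \<Longrightarrow> ip (\<lambda>x. f (x \<otimes> g)) (\<lambda>x. f' (x \<otimes> g)) = ip f f'"
  unfolding ip_def by (rule sum_translate_right)

lemma conv_translate:
  "g \<in> carrier G \<Longrightarrow> x \<in> carrier G \<Longrightarrow> conv h (\<lambda>x. f (x \<otimes> g)) x = conv h f (x \<otimes> g)"
  unfolding conv_def by (rule sum.cong) (auto simp: m_assoc)

text \<open>Views the convolution as a matrix with row
  \<open>y \<mapsto> h (x \<otimes> inv y)\<close> at \<open>x\<close>. By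
  \<open>ip_translate_inv\<close> every row has squared norm \<open>ip h h\<close>, so the squared
  Hilbert-Schmidt norm is \<open>order G * ip h h\<close>.\<close>

lemma conv_eq_ip:
  assumes "x \<in> carrier G"
  shows "conv h f x = ip (\<lambda>y. h (x \<otimes> inv y)) f"
proof -
  have "ip (\<lambda>y. h (x \<otimes> inv y)) f = (\<Sum>z\<in>carrier G. h (x \<otimes> z) * f (inv z))"
    unfolding ip_def using sum_inv[of "\<lambda>z. h (x \<otimes> z) * f (inv z)"] by simp
  also have "\<dots> = (\<Sum>z\<in>carrier G. h (x \<otimes> z) * f (inv (x \<otimes> z) \<otimes> x))"
    using assms by (intro sum.cong) (auto simp: inv_mult_group m_assoc)
  also have "\<dots> = conv h f x"
    unfolding conv_def using assms by (rule sum_translate_left)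
  finally show ?thesis by simp
qed

lemma ip_translate_inv:
  assumes "x \<in> carrier G"
  shows "ip (\<lambda>y. h (x \<otimes> inv y)) (\<lambda>y. h (x \<otimes> inv y)) = ip h h"
  unfolding ip_def using sum_inv[of "\<lambda>y. h (x \<otimes> y) * h (x \<otimes> y)"]
    sum_translate_left[OF assms, of "\<lambda>y. h y * h y"] by simp

section \<open>Norm bounds for convolution operators\<close>

lemma conv_bound: "ip (conv h f) (conv h f) \<le> order G * ip h h * ip f f"
proof -
  have "ip (conv h f) (conv h f) \<le> (\<Sum>x\<in>carrier G. ip h h * ip f f)"
    unfolding ip_def[of "conv h f"]
  proof (rule sum_mono)
    fix x assume "x \<in> carrier G"
    then show "conv h f x * conv h f x \<le> ip h h * ip f f"
      using ip_Cauchy_Schwarz[of "\<lambda>y. h (x \<otimes> inv y)" f]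
      by (simp add: conv_eq_ip ip_translate_inv power2_eq_square)
  qed
  then show ?thesis
    by (simp add: order_def)
qed

text \<open>The Gram matrix of the \<open>g i\<close> has at most \<open>m\<close> nonzero entries
  per row, each at most \<open>B\<close> in absolute value, so its norm is at most
  \<open>m * B\<close>. Pairing \<open>k\<close> with the combination \<open>y\<close> of the
  \<open>g i\<close> weighted by its own coefficients gives the bound by duality.\<close>

lemma almost_orthogonal_Bessel:
  assumes "finite I" and B: "B \<ge> 0" and norm: "\<And>i. i \<in> I \<Longrightarrow> ip (g i) (g i) = B"
    and sparse: "\<And>i. i \<in> I \<Longrightarrow> card {j \<in> I. ip (g i) (g j) \<noteq> 0} \<le> m"
  shows "(\<Sum>i\<in>I. (ip k (g i))\<^sup>2) \<le> m * B * ip k k"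
proof -
  define w where "w i = ip k (g i)" for i
  define S where "S = (\<Sum>i\<in>I. (w i)\<^sup>2)"
  define y where "y x = (\<Sum>i\<in>I. w i * g i x)" for x
  have "ip k y = S"
    unfolding y_def S_def ip_sum_right by (simp add: ip_scale_right w_def power2_eq_square)
  moreover have "ip y y \<le> m * B * S"
  proof -
    \<comment> \<open>A symmetric majorant of the Gram matrix. With \<open>\<bar>w i * w j\<bar>
      \<le> ((w i)\<^sup>2 + (w j)\<^sup>2) / 2\<close>, its row sums alone bound the quadratic form
      (Schur's test).\<close>
    define e where "e i j = (if ip (g i) (g j) \<noteq> 0 then B else 0)" for i j
    have e_sym: "e i j = e j i" for i j
      by (simp add: e_def ip_commute)
    have entry: "\<bar>ip (g i) (g j)\<bar> \<le> e i j" if "i \<in> I" "j \<in> I" for i j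
    proof -
      have "(ip (g i) (g j))\<^sup>2 \<le> B\<^sup>2"
        using ip_Cauchy_Schwarz[of "g i" "g j"] that by (simp add: norm power2_eq_square)
      then show ?thesis
        using B abs_le_square_iff[of "ip (g i) (g j)" B] by (simp add: e_def)
    qed
    have row: "(\<Sum>j\<in>I. e i j) \<le> m * B" if "i \<in> I" for i
    proof -
      have "(\<Sum>j\<in>I. e i j) = card {j \<in> I. ip (g i) (g j) \<noteq> 0} * B"
        unfolding e_def using \<open>finite I\<close> by (simp add: sum.If_cases Int_def conj_commute)
      also have "\<dots> \<le> m * B"
        using sparse[OF that] B by (intro mult_right_mono) auto
      finally show ?thesis .
    qed
    have "ip y y = (\<Sum>i\<in>I. \<Sum>j\<in>I. w i * w j * ip (g i) (g j))"
      unfolding y_def ip_sum_right ip_sum_left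
      by (simp add: ip_scale_left ip_scale_right mult_ac)
    also have "\<dots> \<le> (\<Sum>i\<in>I. \<Sum>j\<in>I. ((w i)\<^sup>2 + (w j)\<^sup>2) / 2 * e i j)"
    proof (intro sum_mono)
      fix i j assume ij: "i \<in> I" "j \<in> I"
      have "\<bar>w i * w j\<bar> \<le> ((w i)\<^sup>2 + (w j)\<^sup>2) / 2"
        using sum_squares_bound[of "\<bar>w i\<bar>" "\<bar>w j\<bar>"] by (simp add: abs_mult)
      then have "\<bar>w i * w j * ip (g i) (g j)\<bar> \<le> ((w i)\<^sup>2 + (w j)\<^sup>2) / 2 * e i j"
        unfolding abs_mult[of "w i * w j"] using entry[OF ij] by (intro mult_mono) auto
      then show "w i * w j * ip (g i) (g j) \<le> ((w i)\<^sup>2 + (w j)\<^sup>2) / 2 * e i j"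
        by linarith
    qed
    also have "\<dots> = (\<Sum>i\<in>I. \<Sum>j\<in>I. (w i)\<^sup>2 * e i j) / 2 + (\<Sum>i\<in>I. \<Sum>j\<in>I. (w j)\<^sup>2 * e i j) / 2"
      by (simp add: add_divide_distrib distrib_right sum.distrib sum_divide_distrib)
    also have "(\<Sum>i\<in>I. \<Sum>j\<in>I. (w j)\<^sup>2 * e i j) = (\<Sum>i\<in>I. \<Sum>j\<in>I. (w i)\<^sup>2 * e i j)"
      by (subst sum.swap) (simp add: e_sym)
    also have "(\<Sum>i\<in>I. \<Sum>j\<in>I. (w i)\<^sup>2 * e i j) / 2 + (\<Sum>i\<in>I. \<Sum>j\<in>I. (w i)\<^sup>2 * e i j) / 2
        = (\<Sum>i\<in>I. (w i)\<^sup>2 * (\<Sum>j\<in>I. e i j))"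
      by (simp add: sum_distrib_left)
    also have "\<dots> \<le> (\<Sum>i\<in>I. (w i)\<^sup>2 * (m * B))"
      by (intro sum_mono mult_left_mono row) auto
    finally show ?thesis
      by (simp add: S_def sum_distrib_left mult_ac)
  qed
  ultimately have "S * S \<le> (m * B * ip k k) * S"
    using ip_Cauchy_Schwarz[of k y] ip_nonneg[of k]
    by (smt (verit, best) mult_left_mono mult.assoc mult.commute power2_eq_square)
  moreover have "S \<ge> 0" "m * B * ip k k \<ge> 0"
    using B ip_nonneg by (simp_all add: S_def sum_nonneg)
  ultimately have "S \<le> m * B * ip k k"
    by (metis mult_le_cancel_right less_eq_real_def not_less)
  then show ?thesis
    by (simp add: S_def w_def)
qed

text \<open>Translation invariance of the convolution spreads its Hilbert-Schmidt norm over the orbit.\<close>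

lemma conv_bound_translates:
  assumes "finite I" and d: "\<And>i. i \<in> I \<Longrightarrow> d i \<in> carrier G"
    and sparse: "\<And>i. i \<in> I \<Longrightarrow>
      card {j \<in> I. ip (\<lambda>x. f (x \<otimes> d i)) (\<lambda>x. f (x \<otimes> d j)) \<noteq> 0} \<le> m"
  shows "real (card I) * ip (conv h f) (conv h f) \<le> real m * real (order G) * ip h h * ip f f"
proof -
  define g where "g = (\<lambda>i x. f (x \<otimes> d i))"
  have norm_g: "ip (g i) (g i) = ip f f" if "i \<in> I" for i
    unfolding g_def using d[OF that] by (rule ip_translate)
  have "real (card I) * ip (conv h f) (conv h f) = (\<Sum>i\<in>I. ip (conv h (g i)) (conv h (g i)))"
  proof -
    have "ip (conv h (g i)) (conv h (g i)) = ip (conv h f) (conv h f)" if "i \<in> I" for i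
      unfolding g_def using d[OF that]
      by (simp add: ip_translate conv_translate cong: ip_cong)
    then show ?thesis by simp
  qed
  \<comment> \<open>Exchanging the sums collects, for each row of the convolution, its coefficients
    against all translates, to which the Bessel bound applies.\<close>
  also have "\<dots> = (\<Sum>x\<in>carrier G. \<Sum>i\<in>I. (ip (\<lambda>y. h (x \<otimes> inv y)) (g i))\<^sup>2)"
    unfolding ip_def[of "conv h _"] by (subst sum.swap) (simp add: conv_eq_ip power2_eq_square)
  also have "\<dots> \<le> (\<Sum>x\<in>carrier G. m * ip f f * ip h h)"
  proof (rule sum_mono)
    fix x assume x: "x \<in> carrier G"
    have "(\<Sum>i\<in>I. (ip (\<lambda>y. h (x \<otimes> inv y)) (g i))\<^sup>2)
        \<le> m * ip f f * ip (\<lambda>y. h (x \<otimes> inv y)) (\<lambda>y. h (x \<otimes> inv y))"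
      by (rule almost_orthogonal_Bessel)
         (use \<open>finite I\<close> norm_g sparse in \<open>auto simp: ip_nonneg g_def\<close>)
    then show "(\<Sum>i\<in>I. (ip (\<lambda>y. h (x \<otimes> inv y)) (g i))\<^sup>2) \<le> m * ip f f * ip h h"
      by (simp add: ip_translate_inv[OF x])
  qed
  finally show ?thesis
    by (simp add: order_def mult_ac)
qed

text \<open>With \<open>T\<close> the convolution by the indicator of \<open>X\<close>, the count of pairs in \<open>X\<close> with product
  in \<open>X\<close> has main term \<open>card X ^ 3 / order G\<close>; a small norm of \<open>T\<close> on sum-zero functions makes
  the error term too small to cancel it.\<close>

lemma product_free_card_bound:
  fixes \<beta> :: real
  assumes pf: "product_free G X" and \<beta>: "\<beta> \<ge> 0"
    and mixing: "\<And>f h. (\<Sum>x\<in>carrier G. f x) = 0 \<Longrightarrow>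
      ip (conv h f) (conv h f) \<le> \<beta> * order G * ip h h * ip f f"
  shows "real (card X) ^ 3 \<le> \<beta> * real (order G) ^ 3"
proof (cases "X = {}")
  case True
  then show ?thesis
    using \<beta> by simp
next
  case False
  define N where "N = real (order G)"
  define m where "m = real (card X)"
  define h where "h x = (of_bool (x \<in> X) :: real)" for x
  \<comment> \<open>The balanced indicator: subtracting the density \<open>m / N\<close> makes the
    sum zero, so that \<open>mixing\<close> applies.\<close>
  define f where "f x = h x - m / N" for x
  have X: "X \<subseteq> carrier G"
    using pf by (simp add: product_free_def)
  then have finX: "finite X"
    using finite_carrier finite_subset by blast
  have m: "m > 0"
    using False finX by (simp add: m_def card_gt_0_iff)
  have N: "N > 0"
    using finite_carrier by (simp add: N_def order_def card_gt_0_iff) (use one_closed in blast)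
  have sum_h: "(\<Sum>x\<in>carrier G. h x) = m"
    unfolding h_def m_def using X finite_carrier by (simp add: of_bool_def sum.If_cases Int_absorb1)
  have hh: "h x * h x = h x" for x
    by (simp add: h_def)
  have ip_h: "ip h h = m"
    by (simp add: ip_def hh sum_h)
  have sum_f: "(\<Sum>x\<in>carrier G. f x) = 0"
    using N by (simp add: f_def sum_subtractf sum_h N_def order_def)
  have "ip f f = (\<Sum>x\<in>carrier G. h x * (1 - 2 * (m / N)) + (m / N)\<^sup>2)"
    unfolding ip_def f_def
    by (intro sum.cong refl) (simp add: power2_eq_square algebra_simps hh)
  also have "\<dots> = m * (1 - 2 * (m / N)) + N * (m / N)\<^sup>2"
    by (simp add: sum.distrib sum_h N_def order_def flip: sum_distrib_right)
  also have "\<dots> = m - m\<^sup>2 / N"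
    using N by (simp add: field_simps power2_eq_square)
  finally have ip_f: "ip f f \<le> m"
    using N by simp
  have "conv h h x = conv h f x + m\<^sup>2 / N" if "x \<in> carrier G" for x
  proof -
    have "conv h f x = conv h h x - (\<Sum>z\<in>carrier G. h z * (m / N))"
      by (simp add: conv_def f_def right_diff_distrib sum_subtractf)
    also have "(\<Sum>z\<in>carrier G. h z * (m / N)) = m\<^sup>2 / N"
      by (subst sum_distrib_right[symmetric]) (simp add: sum_h power2_eq_square)
    finally show ?thesis by simp
  qed
  then have "ip h (conv h h) = (\<Sum>x\<in>carrier G. h x * conv h f x + h x * (m\<^sup>2 / N))"
    unfolding ip_def by (intro sum.cong) (auto simp: distrib_left)
  also have "\<dots> = ip h (conv h f) + m * (m\<^sup>2 / N)"
    by (simp add: ip_def sum.distrib sum_h del: times_divide_eq_right flip: sum_distrib_right)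
  finally have split: "ip h (conv h h) = ip h (conv h f) + m ^ 3 / N"
    by (simp add: power3_eq_cube power2_eq_square)
  \<comment> \<open>A nonzero term would exhibit \<open>z\<close> and
    \<open>inv z \<otimes> x\<close> in \<open>X\<close> with product \<open>x\<close> in
    \<open>X\<close>.\<close>
  have "h x * (h z * h (inv z \<otimes> x)) = 0" if "x \<in> carrier G" "z \<in> carrier G" for x z
  proof (rule ccontr)
    assume "h x * (h z * h (inv z \<otimes> x)) \<noteq> 0"
    then have "x \<in> X" "z \<in> X" "inv z \<otimes> x \<in> X"
      by (auto simp: h_def)
    moreover have "z \<otimes> (inv z \<otimes> x) = x"
      using that by (simp flip: m_assoc)
    ultimately show False
      using pf unfolding product_free_def by metis
  qed
  then have "ip h (conv h h) = 0"
    unfolding ip_def conv_def sum_distrib_left by (intro sum.neutral ballI) blast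
  with split have "ip h (conv h f) = - (m ^ 3 / N)"
    by simp
  \<comment> \<open>The error term must cancel the main term exactly; Cauchy-Schwarz and
    \<open>mixing\<close> limit its size, and a factor \<open>m ^ 3\<close> cancels at the
    end.\<close>
  then have "(m ^ 3 / N)\<^sup>2 \<le> m * ip (conv h f) (conv h f)"
    using ip_Cauchy_Schwarz[of h "conv h f"] by (simp add: ip_h)
  also have "\<dots> \<le> m * (\<beta> * N * m * m)"
  proof (rule mult_left_mono)
    have "ip (conv h f) (conv h f) \<le> \<beta> * N * m * ip f f"
      using mixing[OF sum_f, of h] by (simp add: ip_h N_def)
    also have "\<dots> \<le> \<beta> * N * m * m"
      using \<beta> N m ip_f by (intro mult_left_mono) auto
    finally show "ip (conv h f) (conv h f) \<le> \<beta> * N * m * m" .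
  qed (use m in simp)
  finally have "m ^ 3 * m ^ 3 \<le> (\<beta> * N ^ 3) * m ^ 3"
    using N by (simp add: field_simps power2_eq_square power3_eq_cube)
  then have "m ^ 3 \<le> \<beta> * N ^ 3"
    using m by (simp only: mult_le_cancel_right_pos zero_less_power)
  then show ?thesis
    by (simp only: m_def N_def)
qed

end

section \<open>Spectral decomposition under a unipotent subgroup\<close>

text \<open>\<open>u\<close> and \<open>d\<close> parametrize the unipotent upper triangular and the diagonal matrices of
  \<open>SL2\<close>, and \<open>C\<close> is the real part of a nontrivial additive character.\<close>

locale unipotent_group = fin_group G for G (structure) +
  fixes u d :: "'k::{field,finite} \<Rightarrow> 'a" and C :: "'k \<Rightarrow> real"
  assumes u_closed [simp, intro]: "u t \<in> carrier G"
    and d_closed: "s \<noteq> 0 \<Longrightarrow> d s \<in> carrier G"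
    and u_add: "u (s + t) = u s \<otimes> u t"
    and u_d: "s \<noteq> 0 \<Longrightarrow> u t \<otimes> d s = d s \<otimes> u (t / s\<^sup>2)"
    and C_add: "C (x + y) + C (x - y) = 2 * C x * C y"
    and C_0: "C 0 = 1"
    and C_nontrivial: "\<exists>y. C y \<noteq> 1"
begin

text \<open>The component of frequency \<open>a\<close> under the right action of the subgroup
  \<open>u\<close>; for \<open>a = 0\<close> it is the average over that subgroup. As
  \<open>C\<close> is even, \<open>a\<close> and \<open>- a\<close> give the same component, so
  \<open>proj a\<close> is only half of a projection when \<open>a \<noteq> - a\<close>.\<close>

definition proj :: "'k \<Rightarrow> ('a \<Rightarrow> real) \<Rightarrow> 'a \<Rightarrow> real" where
  "proj a f x = (\<Sum>t\<in>UNIV. C (a * t) * f (x \<otimes> u t)) / real CARD('k)"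

text \<open>The scalar by which \<open>proj a\<close> acts on frequency \<open>b\<close>: 1 if
  \<open>a = b = - b\<close>, 1/2 for the other pairs equal up to sign, and 0 otherwise.\<close>

definition proj_coeff :: "'k \<Rightarrow> 'k \<Rightarrow> real" where
  "proj_coeff a b = (of_bool (a = b) + of_bool (a = - b)) / 2"

lemma u_0: "u 0 = \<one>"
  using u_add[of 0 0] by simp

lemma u_minus: "u t \<otimes> u (- t) = \<one>"
  using u_add[of t "- t"] by (simp add: u_0)

lemma C_even: "C (- x) = C x"
  using C_add[of 0 x] by (simp add: C_0)

lemma sum_UNIV_shift: "(\<Sum>t\<in>UNIV. g (t + s)) = (\<Sum>t\<in>UNIV. g t)" for s :: 'k and g :: "'k \<Rightarrow> real"
  by (rule sum.reindex_bij_witness[of _ "\<lambda>t. t - s" "\<lambda>t. t + s"]) auto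

text \<open>Shifting by \<open>y\<close> and by \<open>- y\<close> and adding shows that the sum is
  multiplied by \<open>C y\<close>, where \<open>C y \<noteq> 1\<close>.\<close>

lemma sum_C_zero: "(\<Sum>t\<in>UNIV. C t) = 0"
proof -
  obtain y where y: "C y \<noteq> 1"
    using C_nontrivial by blast
  have "(\<Sum>t\<in>UNIV. C t) + (\<Sum>t\<in>UNIV. C t) = (\<Sum>t\<in>UNIV. C (t + y)) + (\<Sum>t\<in>UNIV. C (t + - y))"
    by (simp only: sum_UNIV_shift)
  also have "\<dots> = (\<Sum>t\<in>UNIV. 2 * C y * C t)"
    by (simp add: C_add mult_ac flip: sum.distrib)
  also have "\<dots> = 2 * C y * (\<Sum>t\<in>UNIV. C t)"
    by (rule sum_distrib_left[symmetric])
  finally show ?thesis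
    using y by simp
qed

lemma sum_C: "(\<Sum>t\<in>UNIV. C (a * t + b)) = (if a = 0 then real CARD('k) * C b else 0)"
proof (cases "a = 0")
  case False
  have "(\<Sum>t\<in>UNIV. C (a * t + b)) = (\<Sum>t\<in>UNIV. C t)"
    by (rule sum.reindex_bij_witness[of _ "\<lambda>t. (t - b) / a" "\<lambda>t. a * t + b"]) (use False in auto)
  then show ?thesis
    using False by (simp add: sum_C_zero)
qed simp

lemma C_convolution:
  "(\<Sum>s\<in>UNIV. C (a * s) * C (b * (r - s))) = real CARD('k) * proj_coeff a b * C (b * r)"
proof -
  have "C (a * s) * C (b * (r - s)) = (C ((a - b) * s + b * r) + C ((a + b) * s + - (b * r))) / 2" for s
    using C_add[of "a * s" "b * (r - s)"] by (simp add: algebra_simps)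
  then have "(\<Sum>s\<in>UNIV. C (a * s) * C (b * (r - s)))
      = ((\<Sum>s\<in>UNIV. C ((a - b) * s + b * r)) + (\<Sum>s\<in>UNIV. C ((a + b) * s + - (b * r)))) / 2"
    by (simp only: sum.distrib flip: sum_divide_distrib)
  also have "\<dots> = real CARD('k) * proj_coeff a b * C (b * r)"
    unfolding sum_C by (simp add: proj_coeff_def C_even eq_neg_iff_add_eq_0 add_divide_distrib distrib_left distrib_right)
  finally show ?thesis .
qed

text \<open>Composing two averages along \<open>u\<close> convolves their weights, and
  \<open>C_convolution\<close> evaluates the result.\<close>

lemma proj_proj:
  assumes x: "x \<in> carrier G"
  shows "proj a (proj b f) x = proj_coeff a b * proj b f x"
proof -
  have "proj a (proj b f) x
      = (\<Sum>s\<in>UNIV. \<Sum>t\<in>UNIV. C (a * s) * (C (b * t) * f (x \<otimes> u (t + s)))) / (real CARD('k))\<^sup>2"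
    using x by (simp add: proj_def m_assoc u_add[symmetric] add.commute sum_distrib_left power2_eq_square
        flip: sum_divide_distrib)
  also have "(\<Sum>s\<in>UNIV. \<Sum>t\<in>UNIV. C (a * s) * (C (b * t) * f (x \<otimes> u (t + s))))
      = (\<Sum>s\<in>UNIV. \<Sum>r\<in>UNIV. C (a * s) * (C (b * (r - s)) * f (x \<otimes> u r)))"
    using sum_UNIV_shift[of "\<lambda>r. C (a * s) * (C (b * (r - s)) * f (x \<otimes> u r))" s for s] by simp
  also have "\<dots> = (\<Sum>r\<in>UNIV. (\<Sum>s\<in>UNIV. C (a * s) * C (b * (r - s))) * f (x \<otimes> u r))"
    by (subst sum.swap) (simp add: sum_distrib_right mult.assoc)
  also have "\<dots> = real CARD('k) * proj_coeff a b * (\<Sum>r\<in>UNIV. C (b * r) * f (x \<otimes> u r))"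
    unfolding C_convolution by (simp add: sum_distrib_left mult_ac)
  finally show ?thesis
    by (simp add: proj_def[of b f x] power2_eq_square)
qed

lemma proj_eq_sum: "proj a f = (\<lambda>x. \<Sum>t\<in>UNIV. C (a * t) / real CARD('k) * f (x \<otimes> u t))"
  by (simp add: proj_def[abs_def] sum_divide_distrib)

lemma ip_proj: "ip (proj a f) g = ip f (proj a g)"
proof -
  have translate: "ip (\<lambda>x. f (x \<otimes> u t)) g = ip f (\<lambda>x. g (x \<otimes> u (- t)))" for t
  proof -
    have "ip (\<lambda>x. f (x \<otimes> u t)) g = ip (\<lambda>x. f (x \<otimes> u t)) (\<lambda>x. g (x \<otimes> u t \<otimes> u (- t)))"
      by (rule ip_cong) (auto simp: m_assoc u_minus)
    also have "\<dots> = ip f (\<lambda>x. g (x \<otimes> u (- t)))"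
      by (rule ip_translate) auto
    finally show ?thesis .
  qed
  have "ip (proj a f) g = (\<Sum>t\<in>UNIV. C (a * t) / real CARD('k) * ip (\<lambda>x. f (x \<otimes> u t)) g)"
    unfolding proj_eq_sum ip_sum_left ip_scale_left ..
  also have "\<dots> = (\<Sum>t\<in>UNIV. C (a * t) / real CARD('k) * ip f (\<lambda>x. g (x \<otimes> u (- t))))"
    by (simp only: translate)
  also have "\<dots> = (\<Sum>t\<in>UNIV. C (a * t) / real CARD('k) * ip f (\<lambda>x. g (x \<otimes> u t)))"
    by (rule sum.reindex_bij_witness[of _ uminus uminus]) (auto simp: C_even)
  also have "\<dots> = ip f (proj a g)"
    unfolding proj_eq_sum ip_sum_right ip_scale_right ..
  finally show ?thesis .
qed

text \<open>Fourier inversion: summing over frequencies kills every shift \<open>t\<close> except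
  \<open>t = 0\<close>.\<close>

lemma sum_proj:
  assumes "x \<in> carrier G"
  shows "(\<Sum>a\<in>UNIV. proj a f x) = f x"
proof -
  have "(\<Sum>a\<in>UNIV. proj a f x) = (\<Sum>t\<in>UNIV. (\<Sum>a\<in>UNIV. C (t * a + 0)) * f (x \<otimes> u t)) / real CARD('k)"
    unfolding proj_def sum_divide_distrib[symmetric]
    by (subst sum.swap) (simp add: sum_distrib_right mult.commute[of _ "_ :: 'k"])
  also have "\<dots> = (\<Sum>t\<in>UNIV. if t = 0 then real CARD('k) * f (x \<otimes> u t) else 0) / real CARD('k)"
    unfolding sum_C by (intro arg_cong[where f = "\<lambda>z. z / real CARD('k)"] sum.cong) (auto simp: C_0)
  also have "\<dots> = f x"
    using assms by (simp add: u_0)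
  finally show ?thesis .
qed

text \<open>The division by \<open>proj_coeff 1 1\<close> compensates for the half projections: it
  doubles the nonzero frequencies outside characteristic 2 and changes nothing in characteristic
  2.\<close>

lemma Parseval:
  "ip f f = ip (proj 0 f) (proj 0 f)
     + (\<Sum>a\<in>-{0}. ip (proj a f) (proj a f)) / proj_coeff 1 1"
proof -
  have sq: "ip (proj a f) (proj a f) = proj_coeff a a * ip f (proj a f)" for a
  proof -
    have "ip (proj a f) (proj a f) = ip f (\<lambda>x. proj_coeff a a * proj a f x)"
      unfolding ip_proj by (rule ip_cong) (auto simp: proj_proj)
    then show ?thesis
      by (simp add: ip_scale_right)
  qed
  \<comment> \<open>For nonzero \<open>a\<close>, the equation \<open>a = - a\<close> holds exactly
    in characteristic 2, whatever \<open>a\<close> is.\<close>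
  have coeff: "proj_coeff a a = proj_coeff 1 1" if "a \<noteq> 0" for a
  proof -
    have "a = - a \<longleftrightarrow> a * (1 + 1) = 0"
      by (simp only: eq_neg_iff_add_eq_0 distrib_left mult_1_right)
    also have "\<dots> \<longleftrightarrow> (1 :: 'k) = - 1"
      using that by (simp only: eq_neg_iff_add_eq_0 mult_eq_0_iff simp_thms)
    finally show ?thesis
      by (simp add: proj_coeff_def)
  qed
  have pos: "proj_coeff 1 1 > 0"
    by (simp add: proj_coeff_def)
  have "ip f f = ip f (\<lambda>x. \<Sum>a\<in>UNIV. proj a f x)"
    by (rule ip_cong) (auto simp: sum_proj)
  also have "\<dots> = (\<Sum>a\<in>UNIV. ip f (proj a f))"
    by (rule ip_sum_right)
  also have "\<dots> = ip f (proj 0 f) + (\<Sum>a\<in>-{0}. ip f (proj a f))"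
    unfolding Compl_eq_Diff_UNIV by (rule sum.remove) auto
  also have "ip f (proj 0 f) = ip (proj 0 f) (proj 0 f)"
    by (simp add: sq proj_coeff_def)
  also have "(\<Sum>a\<in>-{0}. ip f (proj a f)) = (\<Sum>a\<in>-{0}. ip (proj a f) (proj a f) / proj_coeff 1 1)"
  proof (rule sum.cong)
    fix a :: 'k assume "a \<in> -{0}"
    then have "proj_coeff a a = proj_coeff 1 1"
      by (intro coeff) simp
    then show "ip f (proj a f) = ip (proj a f) (proj a f) / proj_coeff 1 1"
      using pos by (simp add: sq)
  qed simp
  finally show ?thesis
    by (simp add: sum_divide_distrib)
qed

lemma conv_proj:
  assumes "x \<in> carrier G"
  shows "conv h (proj a f) x = proj a (conv h f) x"
proof -
  have "conv h (proj a f) x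
      = (\<Sum>z\<in>carrier G. \<Sum>t\<in>UNIV. C (a * t) * (h z * f (inv z \<otimes> (x \<otimes> u t)))) / real CARD('k)"
    using assms
    by (simp add: conv_def proj_def m_assoc sum_distrib_left mult_ac flip: sum_divide_distrib)
  also have "\<dots> = proj a (conv h f) x"
    by (subst sum.swap) (simp add: conv_def proj_def sum_distrib_left)
  finally show ?thesis .
qed

section \<open>Torus action on frequencies\<close>

lemma proj_torus:
  assumes "x \<in> carrier G" "s \<noteq> 0"
  shows "proj b (\<lambda>x. f (x \<otimes> d s)) x = proj (b * s\<^sup>2) f (x \<otimes> d s)"
proof -
  have "x \<otimes> u t \<otimes> d s = x \<otimes> d s \<otimes> u (t / s\<^sup>2)" for t
    using assms by (simp add: m_assoc d_closed u_d)
  then have "(\<Sum>t\<in>UNIV. C (b * t) * f (x \<otimes> u t \<otimes> d s))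
      = (\<Sum>t\<in>UNIV. C (b * t) * f (x \<otimes> d s \<otimes> u (t / s\<^sup>2)))"
    by simp
  also have "\<dots> = (\<Sum>t\<in>UNIV. C (b * s\<^sup>2 * t) * f (x \<otimes> d s \<otimes> u t))"
    by (rule sum.reindex_bij_witness[of _ "\<lambda>t. s\<^sup>2 * t" "\<lambda>t. t / s\<^sup>2"])
       (use assms in \<open>auto simp: mult.assoc\<close>)
  finally show ?thesis
    by (simp add: proj_def)
qed

text \<open>Translating by \<open>d s\<close> turns frequency \<open>a\<close> into
  \<open>a / s\<^sup>2\<close>, and self-adjointness makes components orthogonal whose frequencies
  differ even up to sign.\<close>

lemma proj_translates_orthogonal:
  assumes a: "a \<noteq> 0" and s: "s \<noteq> 0" "s' \<noteq> 0" and ne: "s'\<^sup>2 \<noteq> s\<^sup>2" "s'\<^sup>2 \<noteq> - s\<^sup>2"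
  shows "ip (\<lambda>x. proj a f (x \<otimes> d s)) (\<lambda>x. proj a f (x \<otimes> d s')) = 0"
proof -
  define g where "g = (\<lambda>s x. proj a f (x \<otimes> d s))"
  have eigen: "proj (a / s\<^sup>2) (g s) x = proj_coeff a a * g s x" if "x \<in> carrier G" "s \<noteq> 0" for s x
    using that unfolding g_def by (simp add: proj_torus proj_proj d_closed)
  have pos: "proj_coeff a a > 0"
    by (simp add: proj_coeff_def)
  have "proj_coeff a a * (proj_coeff a a * ip (g s) (g s'))
      = ip (proj (a / s\<^sup>2) (g s)) (proj (a / s'\<^sup>2) (g s'))"
    using s by (simp add: eigen ip_scale_left ip_scale_right cong: ip_cong)
  also have "\<dots> = ip (g s) (\<lambda>x. proj_coeff (a / s\<^sup>2) (a / s'\<^sup>2) * proj (a / s'\<^sup>2) (g s') x)"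
    unfolding ip_proj by (rule ip_cong) (auto simp: proj_proj)
  also have "proj_coeff (a / s\<^sup>2) (a / s'\<^sup>2) = 0"
    using a ne by (auto simp: proj_coeff_def minus_divide_right divide_cancel_left simp del: divide_minus_right)
  finally show ?thesis
    using pos by (simp add: g_def ip_def)
qed

lemma card_same_square: "card {j :: 'k. j\<^sup>2 = b} \<le> 2"
proof (cases "\<exists>j. j\<^sup>2 = b")
  case True
  then obtain j where "j\<^sup>2 = b" by blast
  then have "{j :: 'k. j\<^sup>2 = b} \<subseteq> {j, - j}"
    by (auto simp: power2_eq_iff)
  then have "card {j :: 'k. j\<^sup>2 = b} \<le> card {j, - j}"
    by (intro card_mono) auto
  also have "\<dots> \<le> 2"
    by (simp add: card_insert_if)
  finally show ?thesis .
qed simp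

text \<open>The orbit under the torus consists of \<open>q - 1\<close> translates, \<open>q\<close>
  being the field size. The translate at \<open>i\<close> can fail to be orthogonal to the one at
  \<open>j\<close> only if \<open>j\<^sup>2\<close> is \<open>i\<^sup>2\<close> or
  \<open>- i\<^sup>2\<close>, with at most two solutions each; hence the factor 4.\<close>

lemma conv_proj_bound:
  assumes "a \<noteq> 0"
  shows "(real CARD('k) - 1) * ip (conv h (proj a f)) (conv h (proj a f))
    \<le> 4 * order G * ip h h * ip (proj a f) (proj a f)"
proof -
  have "card {j \<in> -{0}. ip (\<lambda>x. proj a f (x \<otimes> d i)) (\<lambda>x. proj a f (x \<otimes> d j)) \<noteq> 0} \<le> 4"
    if "i \<in> -{0}" for i
  proof -
    have "{j \<in> -{0}. ip (\<lambda>x. proj a f (x \<otimes> d i)) (\<lambda>x. proj a f (x \<otimes> d j)) \<noteq> 0}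
        \<subseteq> {j. j\<^sup>2 = i\<^sup>2} \<union> {j. j\<^sup>2 = - i\<^sup>2}"
      using proj_translates_orthogonal[OF assms] that by blast
    then have "card {j \<in> -{0}. ip (\<lambda>x. proj a f (x \<otimes> d i)) (\<lambda>x. proj a f (x \<otimes> d j)) \<noteq> 0}
        \<le> card ({j. j\<^sup>2 = i\<^sup>2} \<union> {j. j\<^sup>2 = - i\<^sup>2})"
      by (intro card_mono) auto
    also have "\<dots> \<le> card {j. j\<^sup>2 = i\<^sup>2} + card {j. j\<^sup>2 = - i\<^sup>2}"
      by (rule card_Un_le)
    also have "\<dots> \<le> 4"
      using card_same_square[of "i\<^sup>2"] card_same_square[of "- i\<^sup>2"] by linarith
    finally show ?thesis .
  qed
  then have "real (card (-{0 :: 'k})) * ip (conv h (proj a f)) (conv h (proj a f))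
      \<le> real 4 * real (order G) * ip h h * ip (proj a f) (proj a f)"
    by (intro conv_bound_translates[where d = d]) (auto simp: d_closed)
  moreover have "real (card (-{0 :: 'k})) = real CARD('k) - 1"
    unfolding Compl_eq_Diff_UNIV by (subst card_Diff_singleton) (auto simp: of_nat_diff Suc_leI)
  ultimately show ?thesis
    by simp
qed

lemma q_gt_1: "real CARD('k) > 1"
proof -
  have "card {0, 1 :: 'k} \<le> CARD('k)"
    by (rule card_mono) auto
  then show ?thesis by simp
qed

text \<open>Convolution commutes with every \<open>proj a\<close>, so Parseval for \<open>f\<close>
  and for \<open>conv h f\<close> allows a comparison frequency by frequency. Frequency 0 is fixed
  by the torus and is kept as it is.\<close>

lemma conv_bound_modulo_invariants:
  "ip (conv h f) (conv h f) \<le> ip (conv h (proj 0 f)) (conv h (proj 0 f))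
     + 4 * order G * ip h h / (real CARD('k) - 1) * (ip f f - ip (proj 0 f) (proj 0 f))"
proof -
  define \<gamma> where "\<gamma> = 4 * order G * ip h h / (real CARD('k) - 1)"
  have pos: "proj_coeff 1 1 > 0"
    by (simp add: proj_coeff_def)
  have comm: "ip (proj a (conv h f)) (proj a (conv h f))
      = ip (conv h (proj a f)) (conv h (proj a f))" for a
    by (rule ip_cong) (simp_all add: conv_proj)
  have "ip (conv h (proj a f)) (conv h (proj a f)) \<le> \<gamma> * ip (proj a f) (proj a f)" if "a \<noteq> 0" for a
    using conv_proj_bound[OF that, of h f] q_gt_1 by (simp add: \<gamma>_def field_simps)
  then have "(\<Sum>a\<in>-{0}. ip (conv h (proj a f)) (conv h (proj a f)))
      \<le> \<gamma> * (\<Sum>a\<in>-{0}. ip (proj a f) (proj a f))"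
    unfolding sum_distrib_left by (intro sum_mono) auto
  then have "(\<Sum>a\<in>-{0}. ip (conv h (proj a f)) (conv h (proj a f))) / proj_coeff 1 1
      \<le> \<gamma> * ((\<Sum>a\<in>-{0}. ip (proj a f) (proj a f)) / proj_coeff 1 1)"
    using pos by (simp add: divide_right_mono)
  then show ?thesis
    unfolding Parseval[of "conv h f"] Parseval[of f] comm \<gamma>_def[symmetric] by simp
qed

lemma conv_bound_sum_zero:
  assumes w: "w \<in> carrier G"
    and weyl: "\<And>f. (\<Sum>x\<in>carrier G. f x) = 0 \<Longrightarrow>
      ip (proj 0 (\<lambda>x. proj 0 f (x \<otimes> w))) (proj 0 (\<lambda>x. proj 0 f (x \<otimes> w)))
        \<le> ip (proj 0 f) (proj 0 f) / real CARD('k)"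
    and f: "(\<Sum>x\<in>carrier G. f x) = 0"
  shows "ip (conv h f) (conv h f) \<le> (4 / (real CARD('k) - 1) + 1 / real CARD('k)) * order G * ip h h * ip f f"
proof -
  define \<gamma> where "\<gamma> = 4 * order G * ip h h / (real CARD('k) - 1)"
  \<comment> \<open>Translating the invariant part by \<open>w\<close> changes neither its norm nor
    that of its image, but leaves little of it invariant.\<close>
  define g where "g = (\<lambda>x. proj 0 f (x \<otimes> w))"
  have \<gamma>: "\<gamma> \<ge> 0"
    using q_gt_1 by (simp add: \<gamma>_def ip_nonneg)
  have norm_g: "ip g g = ip (proj 0 f) (proj 0 f)"
    unfolding g_def using w by (rule ip_translate)
  have "ip (conv h g) (conv h g) = ip (\<lambda>x. conv h (proj 0 f) (x \<otimes> w)) (\<lambda>x. conv h (proj 0 f) (x \<otimes> w))"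
    unfolding g_def using w by (intro ip_cong) (simp_all add: conv_translate)
  then have conv_g: "ip (conv h g) (conv h g) = ip (conv h (proj 0 f)) (conv h (proj 0 f))"
    by (simp only: ip_translate[OF w])
  have "proj_coeff 1 1 > 0"
    by (simp add: proj_coeff_def)
  then have Bessel: "ip (proj 0 f) (proj 0 f) \<le> ip f f" for f
    using Parseval[of f] by (simp add: sum_nonneg ip_nonneg)
  have "ip (conv h (proj 0 g)) (conv h (proj 0 g)) \<le> order G * ip h h * ip (proj 0 g) (proj 0 g)"
    by (rule conv_bound)
  also have "\<dots> \<le> order G * ip h h * (ip (proj 0 f) (proj 0 f) / real CARD('k))"
    unfolding g_def by (intro mult_left_mono weyl f) (simp add: ip_nonneg)
  finally have small: "ip (conv h (proj 0 g)) (conv h (proj 0 g))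
      \<le> order G * ip h h / real CARD('k) * ip (proj 0 f) (proj 0 f)"
    by simp
  have "ip (conv h f) (conv h f)
      \<le> ip (conv h g) (conv h g) + \<gamma> * (ip f f - ip (proj 0 f) (proj 0 f))"
    using conv_bound_modulo_invariants[of h f] by (simp add: conv_g \<gamma>_def)
  \<comment> \<open>A second splitting, now of \<open>g\<close>. Its invariant part is small by
    \<open>weyl\<close>, and its remainder costs at most \<open>\<gamma>\<close> times the norm that
    the first splitting left out.\<close>
  also have "ip (conv h g) (conv h g)
      \<le> ip (conv h (proj 0 g)) (conv h (proj 0 g)) + \<gamma> * (ip g g - ip (proj 0 g) (proj 0 g))"
    using conv_bound_modulo_invariants[of h g] by (simp add: \<gamma>_def)
  also have "\<dots> \<le> order G * ip h h / real CARD('k) * ip (proj 0 f) (proj 0 f) + \<gamma> * ip (proj 0 f) (proj 0 f)"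
    using small \<gamma> by (intro add_mono mult_left_mono) (auto simp: norm_g ip_nonneg)
  also have "order G * ip h h / real CARD('k) * ip (proj 0 f) (proj 0 f) \<le> order G * ip h h / real CARD('k) * ip f f"
    by (intro mult_left_mono Bessel) (simp add: ip_nonneg)
  also have "order G * ip h h / real CARD('k) * ip f f + \<gamma> * ip (proj 0 f) (proj 0 f)
      + \<gamma> * (ip f f - ip (proj 0 f) (proj 0 f)) = order G * ip h h / real CARD('k) * ip f f + \<gamma> * ip f f"
    by (simp add: right_diff_distrib)
  also have "\<dots> = (4 / (real CARD('k) - 1) + 1 / real CARD('k)) * order G * ip h h * ip f f"
    by (simp add: \<gamma>_def distrib_right)
  finally show ?thesis
    by simp
qed

end

section \<open>Autocorrelations and quotients\<close>

context fin_group
begin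

lemma sum_autocorrelation:
  "(\<Sum>g\<in>carrier G. ip f (\<lambda>x. f (x \<otimes> g))) = (\<Sum>x\<in>carrier G. f x)\<^sup>2"
proof -
  have "(\<Sum>g\<in>carrier G. ip f (\<lambda>x. f (x \<otimes> g)))
      = (\<Sum>x\<in>carrier G. f x * (\<Sum>g\<in>carrier G. f (x \<otimes> g)))"
    unfolding ip_def by (subst sum.swap) (simp add: sum_distrib_left)
  also have "\<dots> = (\<Sum>x\<in>carrier G. f x * (\<Sum>g\<in>carrier G. f g))"
    by (simp add: sum_translate_left)
  finally show ?thesis
    by (simp add: power2_eq_square flip: sum_distrib_right)
qed

text \<open>Multiplied by \<open>card H\<close>, the sum is the squared norm of the sum of all
  translates of \<open>f\<close> by \<open>H\<close>.\<close>

lemma sum_autocorrelation_subgroup_nonneg: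
  assumes "subgroup H G"
  shows "(\<Sum>g\<in>H. ip f (\<lambda>x. f (x \<otimes> g))) \<ge> 0"
proof -
  interpret H: subgroup H G by fact
  have "finite H"
    using H.subset finite_carrier finite_subset by blast
  then have card: "card H > 0"
    using H.one_closed by (metis card_gt_0_iff empty_iff)
  have "0 \<le> ip (\<lambda>x. \<Sum>h\<in>H. f (x \<otimes> h)) (\<lambda>x. \<Sum>h\<in>H. f (x \<otimes> h))"
    by (rule ip_nonneg)
  also have "\<dots> = (\<Sum>k\<in>H. \<Sum>h\<in>H. ip (\<lambda>x. f (x \<otimes> h)) (\<lambda>x. f (x \<otimes> k)))"
    unfolding ip_sum_right ip_sum_left ..
  also have "\<dots> = (\<Sum>h\<in>H. \<Sum>k\<in>H. ip (\<lambda>x. f (x \<otimes> h)) (\<lambda>x. f (x \<otimes> k)))"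
    by (rule sum.swap)
  also have "\<dots> = (\<Sum>h\<in>H. \<Sum>g\<in>H. ip f (\<lambda>x. f (x \<otimes> g)))"
  proof (rule sum.cong)
    fix h assume h: "h \<in> H"
    have "(\<Sum>k\<in>H. ip (\<lambda>x. f (x \<otimes> h)) (\<lambda>x. f (x \<otimes> k)))
        = (\<Sum>g\<in>H. ip (\<lambda>x. f (x \<otimes> h)) (\<lambda>x. f (x \<otimes> (h \<otimes> g))))"
      by (rule sum.reindex_bij_witness[of _ "\<lambda>g. h \<otimes> g" "\<lambda>k. inv h \<otimes> k"])
         (use h in \<open>auto simp flip: m_assoc\<close>)
    also have "\<dots> = (\<Sum>g\<in>H. ip f (\<lambda>x. f (x \<otimes> g)))"
    proof (rule sum.cong)
      fix g assume "g \<in> H"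
      then have "ip (\<lambda>x. f (x \<otimes> h)) (\<lambda>x. f (x \<otimes> (h \<otimes> g)))
          = ip (\<lambda>x. f (x \<otimes> h)) (\<lambda>x. f (x \<otimes> h \<otimes> g))"
        using h by (intro ip_cong) (auto simp: m_assoc)
      then show "ip (\<lambda>x. f (x \<otimes> h)) (\<lambda>x. f (x \<otimes> (h \<otimes> g))) = ip f (\<lambda>x. f (x \<otimes> g))"
        using ip_translate[of h f "\<lambda>x. f (x \<otimes> g)"] h by simp
    qed simp
    finally show "(\<Sum>k\<in>H. ip (\<lambda>x. f (x \<otimes> h)) (\<lambda>x. f (x \<otimes> k)))
        = (\<Sum>g\<in>H. ip f (\<lambda>x. f (x \<otimes> g)))" .
  qed simp
  finally show ?thesis
    using card by (simp add: zero_le_mult_iff)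
qed

end

context normal
begin

text \<open>Lifts the problem to the covering group: a product in the union would force the product
  of two cosets in \<open>X\<close> to be the coset in \<open>X\<close> that it meets.\<close>

lemma product_free_Union:
  assumes "product_free (G Mod H) X"
  shows "product_free G (\<Union>X)"
proof -
  have X: "X \<subseteq> rcosets H"
    using assms by (simp add: product_free_def FactGroup_def)
  have "x \<otimes> y \<notin> \<Union>X" if xy: "x \<in> \<Union>X" "y \<in> \<Union>X" for x y
  proof
    assume "x \<otimes> y \<in> \<Union>X"
    with xy obtain A B C where ABC: "A \<in> X" "B \<in> X" "C \<in> X" "x \<in> A" "y \<in> B" "x \<otimes> y \<in> C"
      by blast
    then have "A <#> B \<in> rcosets H" "C \<in> rcosets H"
      using X setmult_closed by (auto simp: subset_iff)
    moreover have "x \<otimes> y \<in> A <#> B"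
      using ABC by (auto simp: set_mult_def)
    ultimately have "A <#> B = C"
      using ABC rcos_disjoint[OF subgroup_axioms] by (auto simp: pairwise_def disjnt_def)
    then show False
      using assms ABC by (auto simp: product_free_def FactGroup_def)
  qed
  moreover have "\<Union>X \<subseteq> carrier G"
    using X rcosets_part_G[OF subgroup_axioms] by blast
  ultimately show ?thesis
    by (auto simp: product_free_def)
qed

lemma card_Union_rcosets:
  assumes "X \<subseteq> rcosets H" "finite (carrier G)"
  shows "card (\<Union>X) = card H * card X"
proof -
  have "finite (rcosets H)"
    using assms rcosets_part_G[OF subgroup_axioms] by (metis finite_UnionD)
  then have "finite X"
    using assms finite_subset by blast
  have "card H * card X = card (\<Union>X)"
  proof (rule card_partition)
    show "finite (\<Union>X)"
      using assms rcosets_part_G[OF subgroup_axioms] by (metis Union_mono finite_subset)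
    show "card A = card H" if "A \<in> X" for A
      using that assms card_rcosets_equal[of A H] subset by auto
    show "A \<inter> B = {}" if "A \<in> X" "B \<in> X" "A \<noteq> B" for A B
      using that assms rcos_disjoint[OF subgroup_axioms] by (auto simp: pairwise_def disjnt_def)
  qed fact
  then show ?thesis by simp
qed

end

section \<open>The group \<open>SL2\<close> over a finite field\<close>

definition mat2 :: "'k \<Rightarrow> 'k \<Rightarrow> 'k \<Rightarrow> 'k \<Rightarrow> 'k::field^2^2" where
  "mat2 a b c d = vector [vector [a, b], vector [c, d]]"

lemma mat2_mult:
  "mat2 a b c d ** mat2 a' b' c' d'
     = mat2 (a * a' + b * c') (a * b' + b * d') (c * a' + d * c') (c * b' + d * d')"
  by (simp add: mat2_def matrix_matrix_mult_def vec_eq_iff forall_2 sum_2)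

lemma mat2_one: "mat 1 = mat2 1 0 0 1"
  by (simp add: mat2_def mat_def vec_eq_iff forall_2)

lemma mat2_nth [simp]:
  "mat2 a b c d $ 1 $ 1 = a" "mat2 a b c d $ 1 $ 2 = b"
  "mat2 a b c d $ 2 $ 1 = c" "mat2 a b c d $ 2 $ 2 = d"
  by (simp_all add: mat2_def)

lemma mat2_eq_iff: "mat2 a b c d = mat2 a' b' c' d' \<longleftrightarrow> a = a' \<and> b = b' \<and> c = c' \<and> d = d'"
  by (auto simp: mat2_def vec_eq_iff forall_2)

lemma mat2_cases: obtains a b c d where "A = mat2 a b c d"
proof
  show "A = mat2 (A $ 1 $ 1) (A $ 1 $ 2) (A $ 2 $ 1) (A $ 2 $ 2)"
    by (simp add: mat2_def vec_eq_iff forall_2)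
qed

lemma mat2_in_SL2: "mat2 a b c d \<in> carrier SL2 \<longleftrightarrow> a * d - b * c = 1"
  by (simp add: SL2_def det_2 mat2_def)

lemma SL2_mult: "A \<otimes>\<^bsub>SL2\<^esub> B = A ** B" and SL2_one: "\<one>\<^bsub>SL2\<^esub> = mat2 1 0 0 1"
  by (simp_all add: SL2_def mat2_one)

interpretation SL2: fin_group "SL2 :: ('k::{field,finite}^2^2) monoid"
  by (intro fin_group.intro fin_group_axioms.intro group_SL2) simp

text \<open>The determinant leaves three entries free: a nonzero upper left entry determines the
  lower right one, while a zero there makes the upper right entry determine the lower left
  one.\<close>

lemma order_SL2_le: "order (SL2 :: ('k::{field,finite}^2^2) monoid) \<le> CARD('k) ^ 3"
proof -
  define code :: "'k^2^2 \<Rightarrow> 'k \<times> 'k \<times> 'k" where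
    "code A = (if A $ 1 $ 1 \<noteq> 0 then (A $ 1 $ 1, A $ 1 $ 2, A $ 2 $ 1)
               else (0, A $ 1 $ 2, A $ 2 $ 2))" for A
  have "inj_on code (carrier SL2)"
  proof (rule inj_onI)
    fix A B :: "'k^2^2"
    assume AB: "A \<in> carrier SL2" "B \<in> carrier SL2" "code A = code B"
    obtain a b c d where A: "A = mat2 a b c d" by (rule mat2_cases)
    obtain a' b' c' d' where B: "B = mat2 a' b' c' d'" by (rule mat2_cases)
    have det: "a * d - b * c = 1" "a' * d' - b' * c' = 1"
      using AB by (simp_all add: A B mat2_in_SL2)
    show "A = B"
    proof (cases "a = 0")
      case True
      then have eq: "a' = 0" "b' = b" "d' = d"
        using AB(3) by (auto simp: code_def A B split: if_splits)
      then have "- (b * c) = 1" "- (b * c') = 1"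
        using det True by auto
      then have "b * c = b * c'" and "b \<noteq> 0"
        by (metis minus_minus, auto)
      then show ?thesis
        using eq True by (simp add: A B)
    next
      case False
      then have eq: "a' = a" "b' = b" "c' = c"
        using AB(3) by (auto simp: code_def A B split: if_splits)
      then have "a * d = a * d'"
        using det by (simp add: algebra_simps)
      then show ?thesis
        using eq False by (simp add: A B)
    qed
  qed
  then have "order (SL2 :: ('k^2^2) monoid) \<le> CARD('k \<times> 'k \<times> 'k)"
    unfolding order_def by (rule card_inj_on_le) auto
  then show ?thesis
    by (simp add: power3_eq_cube)
qed

section \<open>The Borel subgroup and the Weyl element\<close>

lemma subgroup_Borel_SL2:
  "subgroup {A \<in> carrier SL2. A $ 2 $ 1 = 0} (SL2 :: ('k::{field,finite}^2^2) monoid)"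
    (is "subgroup ?B _")
proof (rule SL2.subgroupI)
  show "?B \<noteq> {}"
    using SL2.one_closed by (auto simp: SL2_one)
next
  fix A :: "'k^2^2" assume A: "A \<in> ?B"
  obtain a b c d where abcd: "A = mat2 a b c d" by (rule mat2_cases)
  with A have "c = 0" "a * d = 1"
    by (auto simp: mat2_in_SL2)
  moreover from this have "inv\<^bsub>SL2\<^esub> A = mat2 d (- b) 0 a"
    unfolding abcd
    by (intro SL2.inv_equality) (auto simp: SL2_mult SL2_one mat2_mult mat2_eq_iff mat2_in_SL2 mult.commute)
  ultimately show "inv\<^bsub>SL2\<^esub> A \<in> ?B"
    by (simp add: mat2_in_SL2 mult.commute)
next
  fix A B :: "'k^2^2" assume "A \<in> ?B" "B \<in> ?B"
  then show "A \<otimes>\<^bsub>SL2\<^esub> B \<in> ?B"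
    using SL2.m_closed[of A B] by (simp add: SL2_mult) (simp add: matrix_matrix_mult_def sum_2)
qed auto

text \<open>On right \<open>U\<close>-invariant functions the autocorrelation at \<open>g\<close> depends only on the double
  coset \<open>U g U\<close>. Outside the Borel subgroup these are indexed by the lower left entry, with
  lower unipotent representatives; the sum over the Borel subgroup is nonnegative.\<close>

lemma lower_unipotent_autocorrelation:
  fixes F :: "'k::{field,finite}^2^2 \<Rightarrow> real"
  assumes inv: "\<And>x t. x \<in> carrier SL2 \<Longrightarrow> F (x ** mat2 1 t 0 1) = F x"
    and zero: "(\<Sum>x\<in>carrier SL2. F x) = 0"
  shows "(\<Sum>r\<in>-{0}. SL2.ip F (\<lambda>x. F (x ** mat2 1 0 r 1))) \<le> 0"
proof -
  define \<Phi> where "\<Phi> g = SL2.ip F (\<lambda>x. F (x ** g))" for g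
  let ?B = "{A \<in> carrier SL2. A $ 2 $ 1 = 0} :: ('k^2^2) set"
  let ?W = "{A \<in> carrier SL2. A $ 2 $ 1 \<noteq> 0} :: ('k^2^2) set"
  have u: "mat2 1 t 0 1 \<in> carrier SL2" for t :: 'k
    by (simp add: mat2_in_SL2)
  \<comment> \<open>The left factor is absorbed by translating both arguments, the right factor by
    the invariance of \<open>F\<close>.\<close>
  have double_coset: "\<Phi> (mat2 1 s 0 1 ** g ** mat2 1 t 0 1) = \<Phi> g" if g: "g \<in> carrier SL2" for s t g
  proof -
    have "\<Phi> (mat2 1 s 0 1 ** g ** mat2 1 t 0 1)
        = SL2.ip (\<lambda>x. F (x ** mat2 1 s 0 1)) (\<lambda>x. F (x ** mat2 1 s 0 1 ** g))"
      unfolding \<Phi>_def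
    proof (rule SL2.ip_cong)
      fix x :: "'k^2^2" assume x: "x \<in> carrier SL2"
      have "x ** mat2 1 s 0 1 ** g \<in> carrier SL2"
        using SL2.m_closed x u g by (metis SL2_mult)
      then show "F (x ** (mat2 1 s 0 1 ** g ** mat2 1 t 0 1)) = F (x ** mat2 1 s 0 1 ** g)"
        using inv by (simp add: matrix_mul_assoc)
    qed (simp add: inv)
    also have "\<dots> = \<Phi> g"
      using SL2.ip_translate[OF u[of s], of F "\<lambda>x. F (x ** g)"] by (simp add: \<Phi>_def SL2_mult)
    finally show ?thesis .
  qed
  have "0 = (\<Sum>g\<in>carrier SL2. \<Phi> g)"
    using SL2.sum_autocorrelation[of F] by (simp add: \<Phi>_def zero SL2_mult)
  also have "\<dots> = (\<Sum>g\<in>?B \<union> ?W. \<Phi> g)"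
    by (rule sum.cong) auto
  also have "\<dots> = (\<Sum>g\<in>?B. \<Phi> g) + (\<Sum>g\<in>?W. \<Phi> g)"
    by (rule sum.union_disjoint) auto
  also have "(\<Sum>g\<in>?W. \<Phi> g) = (\<Sum>(r, a :: 'k, d :: 'k)\<in>(-{0}) \<times> UNIV \<times> UNIV. \<Phi> (mat2 1 0 r 1))"
  proof -
    define entries :: "'k^2^2 \<Rightarrow> 'k \<times> 'k \<times> 'k" where
      "entries A = (A $ 2 $ 1, A $ 1 $ 1, A $ 2 $ 2)" for A
    define mk :: "'k \<times> 'k \<times> 'k \<Rightarrow> 'k^2^2" where
      "mk = (\<lambda>(r, a, d). mat2 a ((a * d - 1) / r) r d)"
    show ?thesis
    proof (rule sum.reindex_bij_witness[of _ mk entries])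
      fix A :: "'k^2^2" assume A: "A \<in> ?W"
      obtain a b r d where eq: "A = mat2 a b r d" by (rule mat2_cases)
      have r: "r \<noteq> 0" and "a * d - b * r = 1"
        using A by (simp_all add: eq mat2_in_SL2)
      then have b: "b = (a * d - 1) / r"
        by (simp add: field_simps)
      then show "mk (entries A) = A"
        by (simp add: eq mk_def entries_def)
      show "entries A \<in> (-{0}) \<times> UNIV \<times> UNIV"
        using r by (simp add: eq entries_def)
      \<comment> \<open>The Bruhat cell made explicit: its two upper unipotent factors encode the
        diagonal entries, so each \<open>r\<close> accounts for \<open>q\<^sup>2\<close> matrices,
        \<open>q\<close> being the field size.\<close>
      have "A = mat2 1 ((a - 1) / r) 0 1 ** mat2 1 0 r 1 ** mat2 1 ((d - 1) / r) 0 1"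
        using r by (simp add: eq mat2_mult mat2_eq_iff b field_simps)
      then have "\<Phi> A = \<Phi> (mat2 1 0 r 1)"
        using double_coset[of "mat2 1 0 r 1"] by (simp add: mat2_in_SL2)
      then show "(case entries A of (r, a, d) \<Rightarrow> \<Phi> (mat2 1 0 r 1)) = \<Phi> A"
        by (simp add: eq entries_def)
    next
      fix p :: "'k \<times> 'k \<times> 'k" assume "p \<in> (-{0}) \<times> UNIV \<times> UNIV"
      then show "mk p \<in> ?W" "entries (mk p) = p"
        by (auto simp: mk_def entries_def mat2_in_SL2)
    qed
  qed
  also have "\<dots> = (real CARD('k))\<^sup>2 * (\<Sum>r\<in>-{0}. \<Phi> (mat2 1 0 r 1))"
    by (simp add: power2_eq_square sum_distrib_left flip: sum.cartesian_product)
  finally have "(real CARD('k))\<^sup>2 * (\<Sum>r\<in>-{0}. \<Phi> (mat2 1 0 r 1)) = - (\<Sum>g\<in>?B. \<Phi> g)"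
    by simp
  also have "\<dots> \<le> 0"
    using SL2.sum_autocorrelation_subgroup_nonneg[OF subgroup_Borel_SL2, of F]
    by (simp add: \<Phi>_def SL2_mult)
  finally show ?thesis
    by (simp add: \<Phi>_def mult_le_0_iff)
qed

text \<open>Two of the translating elements differ by a right lower unipotent factor with entry
  \<open>r = t - t'\<close>. Expanding the norm thus gives the field size times the sum of
  autocorrelations over \<open>r\<close>: the term \<open>r = 0\<close> is \<open>ip F F\<close>,
  and the others sum to at most 0.\<close>

lemma Weyl_translate_contraction:
  fixes F :: "'k::{field,finite}^2^2 \<Rightarrow> real"
  assumes inv: "\<And>x t. x \<in> carrier SL2 \<Longrightarrow> F (x ** mat2 1 t 0 1) = F x"
    and zero: "(\<Sum>x\<in>carrier SL2. F x) = 0"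
  defines "S \<equiv> (\<lambda>x. \<Sum>t\<in>UNIV. F (x ** mat2 1 t 0 1 ** mat2 0 (- 1) 1 0))"
  shows "SL2.ip S S \<le> real CARD('k) * SL2.ip F F"
proof -
  define h where "h t = mat2 1 t 0 1 ** mat2 0 (- 1) 1 (0 :: 'k)" for t
  have h: "h t \<in> carrier SL2" for t
    by (simp add: h_def mat2_mult mat2_in_SL2)
  have S: "S = (\<lambda>x. \<Sum>t\<in>UNIV. F (x ** h t))"
    by (simp add: S_def h_def matrix_mul_assoc)
  have "SL2.ip S S = (\<Sum>t'\<in>UNIV. \<Sum>t\<in>UNIV. SL2.ip (\<lambda>x. F (x ** h t)) (\<lambda>x. F (x ** h t')))"
    unfolding S SL2.ip_sum_right SL2.ip_sum_left ..
  also have "\<dots> = (\<Sum>t\<in>UNIV. \<Sum>t'\<in>UNIV. SL2.ip (\<lambda>x. F (x ** h t)) (\<lambda>x. F (x ** h t')))"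
    by (rule sum.swap)
  also have "\<dots> = (\<Sum>t\<in>(UNIV :: 'k set). \<Sum>r\<in>UNIV. SL2.ip F (\<lambda>x. F (x ** mat2 1 0 r 1)))"
  proof (rule sum.cong)
    fix t :: 'k
    have shift: "SL2.ip (\<lambda>x. F (x ** h t)) (\<lambda>x. F (x ** h (t - r))) = SL2.ip F (\<lambda>x. F (x ** mat2 1 0 r 1))" for r
    proof -
      have "h (t - r) = h t ** mat2 1 0 r 1"
        by (simp add: h_def mat2_mult)
      then show ?thesis
        using SL2.ip_translate[OF h[of t], of F "\<lambda>x. F (x ** mat2 1 0 r 1)"]
        by (simp add: SL2_mult matrix_mul_assoc)
    qed
    show "(\<Sum>t'\<in>UNIV. SL2.ip (\<lambda>x. F (x ** h t)) (\<lambda>x. F (x ** h t')))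
        = (\<Sum>r\<in>UNIV. SL2.ip F (\<lambda>x. F (x ** mat2 1 0 r 1)))"
      by (intro sum.reindex_bij_witness[of _ "\<lambda>r. t - r" "\<lambda>t'. t - t'"]) (auto simp flip: shift)
  qed simp
  also have "\<dots> = real CARD('k) * (\<Sum>r\<in>UNIV. SL2.ip F (\<lambda>x. F (x ** mat2 1 0 r 1)))"
    by simp
  also have "(\<Sum>r\<in>UNIV. SL2.ip F (\<lambda>x. F (x ** mat2 1 0 r 1)))
      = SL2.ip F F + (\<Sum>r\<in>-{0}. SL2.ip F (\<lambda>x. F (x ** mat2 1 0 r 1)))"
    unfolding Compl_eq_Diff_UNIV by (subst sum.remove[of _ 0]) (simp_all flip: mat2_one)
  also have "real CARD('k) * \<dots> \<le> real CARD('k) * (SL2.ip F F + 0)"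
    by (intro mult_left_mono add_left_mono lower_unipotent_autocorrelation inv zero) auto
  finally show ?thesis
    by simp
qed

lemma SL2_mixing:
  fixes f h :: "'k::{field,finite}^2^2 \<Rightarrow> real"
  assumes "(\<Sum>x\<in>carrier SL2. f x) = 0"
  shows "SL2.ip (SL2.conv h f) (SL2.conv h f)
    \<le> (4 / (real CARD('k) - 1) + 1 / real CARD('k)) * order (SL2 :: ('k^2^2) monoid)
        * SL2.ip h h * SL2.ip f f"
proof -
  obtain C :: "'k \<Rightarrow> real" where C: "\<And>x y. C (x + y) + C (x - y) = 2 * C x * C y" "C 0 = 1" "\<exists>y. C y \<noteq> 1"
    using exists_cosine_character by blast
  define u :: "'k \<Rightarrow> 'k^2^2" where "u t = mat2 1 t 0 1" for t
  define d :: "'k \<Rightarrow> 'k^2^2" where "d s = mat2 s 0 0 (1 / s)" for s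
  interpret unipotent_group SL2 u d C
    by unfold_locales
      (fact C | simp add: u_def d_def mat2_in_SL2 SL2_mult mat2_mult mat2_eq_iff power2_eq_square add.commute)+
  have proj_0: "proj 0 f x = (\<Sum>t\<in>UNIV. f (x ** u t)) / real CARD('k)" for f x
    by (simp add: proj_def C SL2_mult)
  have contraction: "SL2.ip (proj 0 (\<lambda>x. proj 0 f (x \<otimes>\<^bsub>SL2\<^esub> mat2 0 (- 1) 1 0)))
          (proj 0 (\<lambda>x. proj 0 f (x \<otimes>\<^bsub>SL2\<^esub> mat2 0 (- 1) 1 0)))
        \<le> SL2.ip (proj 0 f) (proj 0 f) / real CARD('k)"
    if f: "(\<Sum>x\<in>carrier SL2. f x) = 0" for f
  proof -
    define F where "F = proj 0 f"
    define S where "S = (\<lambda>x. \<Sum>t\<in>UNIV. F (x ** mat2 1 t 0 1 ** mat2 0 (- 1) 1 0))"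
    have "F (x ** mat2 1 t 0 1) = F x" for x t
    proof -
      have "x ** u t ** u s = x ** u (s + t)" for s
        by (simp add: u_def mat2_mult add.commute flip: matrix_mul_assoc)
      then show ?thesis
        using sum_UNIV_shift[of "\<lambda>s. f (x ** u s)" t] by (simp add: F_def proj_0 flip: u_def)
    qed
    moreover have "(\<Sum>x\<in>carrier SL2. F x) = 0"
    proof -
      have "(\<Sum>x\<in>carrier SL2. F x) = (\<Sum>t\<in>UNIV. \<Sum>x\<in>carrier SL2. f (x ** u t)) / real CARD('k)"
        unfolding F_def proj_0 by (subst sum.swap) (simp add: sum_divide_distrib)
      also have "\<dots> = 0"
        using SL2.sum_translate_right[OF u_closed, of f] f by (simp add: SL2_mult)
      finally show ?thesis .
    qed
    ultimately have bound: "SL2.ip S S \<le> real CARD('k) * SL2.ip F F"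
      unfolding S_def by (rule Weyl_translate_contraction)
    \<comment> \<open>Averaging divides by the field size twice in the norm, and the contraction
      gives back one factor.\<close>
    have avg: "proj 0 (\<lambda>x. F (x \<otimes>\<^bsub>SL2\<^esub> mat2 0 (- 1) 1 0)) = (\<lambda>x. 1 / real CARD('k) * S x)"
      by (simp add: proj_0[abs_def] S_def SL2_mult u_def)
    have "SL2.ip (proj 0 (\<lambda>x. F (x \<otimes>\<^bsub>SL2\<^esub> mat2 0 (- 1) 1 0)))
          (proj 0 (\<lambda>x. F (x \<otimes>\<^bsub>SL2\<^esub> mat2 0 (- 1) 1 0)))
        = 1 / real CARD('k) * (1 / real CARD('k) * SL2.ip S S)"
      unfolding avg SL2.ip_scale_left SL2.ip_scale_right ..
    also have "\<dots> \<le> 1 / real CARD('k) * (1 / real CARD('k) * (real CARD('k) * SL2.ip F F))"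
      by (intro mult_left_mono bound) auto
    finally show ?thesis
      by (simp add: F_def)
  qed
  show ?thesis
    by (rule conv_bound_sum_zero[where w = "mat2 0 (- 1) 1 0", OF _ contraction assms])
       (simp_all add: mat2_in_SL2)
qed

section \<open>The bound in \<open>PSL2\<close>\<close>

theorem corollary3p4:
  fixes q n :: nat and \<Gamma> :: "('k::{field,finite}^2^2) set monoid"
  assumes "primepow q" and "CARD('k) = q"
    and "\<Gamma> = PSL2" and "n = card (carrier \<Gamma>)"
  shows "\<not> (\<exists>X. product_free \<Gamma> X \<and> real (card X) > 2 * real n powr (8 / 9))"
proof -
  have "real (card X) \<le> 2 * real n powr (8 / 9)" if pf: "product_free \<Gamma> X" for X
  proof -
    let ?G = "SL2 :: ('k^2^2) monoid" and ?Z = "{mat 1, - mat 1} :: ('k^2^2) set"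
    define \<beta> where "\<beta> = 4 / (real q - 1) + 1 / real q"
    interpret N: normal ?Z ?G
      by (rule normal_center_SL2)
    have X: "X \<subseteq> rcosets\<^bsub>?G\<^esub> ?Z"
      using pf by (simp add: assms(3) PSL2_def product_free_def FactGroup_def)
    have n: "n = card (rcosets\<^bsub>?G\<^esub> ?Z)"
      by (simp add: assms(3,4) PSL2_def FactGroup_def)
    \<comment> \<open>\<open>card ?Z\<close> stays symbolic: it is 1 in characteristic 2 and 2
      otherwise. Its cube cancels when the bound for the preimage is brought back to
      \<open>X\<close>.\<close>
    then have n_order: "n * card ?Z = order ?G"
      using SL2.lagrange[OF N.subgroup_axioms] by simp
    have Z_pos: "card ?Z > 0"
      by (simp add: card_gt_0_iff)
    have q: "q \<ge> 2"
      using primepow_gt_Suc_0[OF assms(1)] by simp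
    have "order ?G > 0"
      using SL2.one_closed by (auto simp: order_def card_gt_0_iff)
    then have n_pos: "n > 0"
      using n_order by (metis gr0I mult_0)
    have "n * 1 \<le> n * card ?Z"
      using Z_pos by (intro mult_left_mono) auto
    then have n_le: "n \<le> q ^ 3"
      using n_order order_SL2_le[where 'k = 'k] assms(2) by simp
    have "product_free ?G (\<Union>X)"
      using pf by (intro N.product_free_Union) (simp add: assms(3) PSL2_def)
    then have "real (card (\<Union>X)) ^ 3 \<le> \<beta> * real (order ?G) ^ 3"
    proof (rule SL2.product_free_card_bound)
      show "\<beta> \<ge> 0"
        using q by (simp add: \<beta>_def)
      show "SL2.ip (SL2.conv h f) (SL2.conv h f) \<le> \<beta> * order ?G * SL2.ip h h * SL2.ip f f"
        if "(\<Sum>x\<in>carrier ?G. f x) = 0" for f h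
        using SL2_mixing[OF that, of h] by (simp add: \<beta>_def assms(2))
    qed
    then have "real (card ?Z) ^ 3 * real (card X) ^ 3 \<le> real (card ?Z) ^ 3 * (\<beta> * real n ^ 3)"
      by (simp add: N.card_Union_rcosets[OF X] power_mult_distrib mult_ac flip: n_order)
    then have m: "real (card X) ^ 3 \<le> \<beta> * real n ^ 3"
      using Z_pos by (simp only: mult_le_cancel_left_pos zero_less_power of_nat_0_less_iff)
    \<comment> \<open>The constant 8 is the cube of the 2 in the claim. For \<open>q \<le> 8\<close>
      the trivial bound \<open>card X \<le> n\<close> suffices; for larger \<open>q\<close>,
      \<open>\<beta>\<close> is below \<open>8 / q\<close>.\<close>
    have "real (card X) ^ 3 \<le> 8 / real q * real n ^ 3"
    proof (cases "q \<le> 8")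
      case True
      have "card X \<le> n"
        unfolding n using X by (intro card_mono) auto
      then have "real (card X) ^ 3 \<le> 1 * real n ^ 3"
        by (simp add: power_mono)
      also have "\<dots> \<le> 8 / real q * real n ^ 3"
        using True q by (intro mult_right_mono) auto
      finally show ?thesis .
    next
      case False
      then have "\<beta> \<le> 8 / real q"
        by (simp add: \<beta>_def field_simps)
      then show ?thesis
        using m by (meson mult_right_mono of_nat_0_le_iff order_trans zero_le_power)
    qed
    moreover have "real n powr (1 / 3) \<le> real q"
    proof -
      have "real n powr (1 / 3) \<le> real (q ^ 3) powr (1 / 3)"
        using n_le by (intro powr_mono2) (auto simp del: of_nat_power)
      also have "\<dots> = real q"
        using q by (simp add: powr_powr flip: powr_numeral)
      finally show ?thesis .
    qed
    ultimately have "real (card X) ^ 3 \<le> 8 / real n powr (1 / 3) * real n ^ 3"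
      using n_pos q by (elim order_trans) (intro mult_right_mono divide_left_mono, auto)
    \<comment> \<open>The exponents match because 3 - 1/3 = 8/3 = 3 * (8/9).\<close>
    also have "\<dots> = (2 * real n powr (8 / 9)) ^ 3"
    proof -
      have "real n ^ 3 = real n powr (1 / 3) * real n powr (8 / 3)"
        using n_pos by (simp flip: powr_add)
      moreover have "(real n powr (8 / 9)) ^ 3 = real n powr (8 / 3)"
        using n_pos by (simp add: powr_power)
      ultimately show ?thesis
        using n_pos by (simp add: power_mult_distrib)
    qed
    finally show ?thesis
      by (subst (asm) power_mono_iff) auto
  qed
  then show ?thesis
    by (meson not_less)
qed

end
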